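(* For every integer $n\geq 0$, $$\int_{-\pi/2}^{\pi/2}\frac{\sin\bigl((\pi/2)\cos\theta+(2n-1)\theta\bigr)\,e^{-(\pi/2)\sin\theta}}{\cosh(\pi\sin\theta)-\cos(\pi\cos\theta)}\,d\theta=(-1)^n B_{2n}\,\pi^{2n}\,\frac{2^{1-2n}-1}{\Gamma(2n+1)} .$$
   Context: $B_n$ denotes the $n$-th Bernoulli number ($x/(e^x-1)=\sum_{n\ge0}B_nx^n/n!$, so $B_0=1$, $B_2=1/6$). *)

theory Defs
  imports "HOL-Analysis.Analysis" "HOL-Computational_Algebra.Formal_Power_Series"
begin

(* Numerator and denominator both have subdegree 1, so the division of formal power
   series is exact; the lemma below makes this explicit. *)
definition bernoulli :: "nat \<Rightarrow> real" where
  "bernoulli n = fact n * fps_nth (fps_X / (fps_exp 1 - 1)) n"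

lemma bernoulli_egf:
  "Abs_fps (\<lambda>n. bernoulli n / fact n) * (fps_exp 1 - 1) = fps_X"
proof -
  have egf: "Abs_fps (\<lambda>n. bernoulli n / fact n) = fps_X / (fps_exp 1 - 1)"
    by (simp add: fps_eq_iff bernoulli_def)
  have nz: "fps_exp (1::real) - 1 \<noteq> 0"
  proof
    assume "fps_exp (1::real) - 1 = 0"
    then have "fps_nth (fps_exp (1::real) - 1) 1 = 0" by (metis fps_zero_nth)
    then show False by simp
  qed
  have "subdegree (fps_exp (1::real) - 1) = 1"
    by (rule subdegreeI) auto
  then have "(fps_exp (1::real) - 1) dvd fps_X"
    using nz by (subst fps_dvd_iff) auto
  then show ?thesis
    unfolding egf by (rule dvd_div_mult_self)
qed

end

theory Submission
  imports Defs "HOL-Complex_Analysis.Complex_Analysis"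
begin

text \<open>
  Put \<open>w = (\<pi>/2) exp (i \<theta>)\<close> and \<open>a = (2n - 1) \<theta>\<close>. The denominator of the integrand is \<open>2 |sin w|\<^sup>2\<close>,
  which suggests a relation to \<open>1 / sin w\<close>. It shows up in the even part: adding the values at \<open>\<theta>\<close> and
  \<open>-\<theta>\<close> produces \<open>2 Re (exp (i a) sin w)\<close> in the numerator (\<open>symmetrised_numerator\<close>), and dividing by
  \<open>2 |sin w|\<^sup>2\<close> leaves \<open>Re (exp (-i a) / sin w)\<close>. As the interval is symmetric, the integral of this
  function is twice the integral in question.

  In terms of the even function \<open>g z = z / sin z\<close>, holomorphic for \<open>|z| < \<pi>\<close>, it equals
  \<open>(2/\<pi>) Re (g w / exp (2 i n \<theta>))\<close>. This has period \<open>\<pi>\<close> in \<open>\<theta>\<close>, so its integral over the half circle is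
  half of the one over the full circle (\<open>has_integral_half_period\<close>), and Cauchy's formula evaluates the
  latter as a multiple of the Taylor coefficient of \<open>g\<close> at \<open>z^(2n)\<close> (\<open>z_csc_circle_integral\<close>). Since
  \<open>1 / sinh (t/2) = 2 / (exp (t/2) - 1) - 2 / (exp t - 1)\<close>, putting \<open>t = 2 i z\<close> in the generating
  function of the Bernoulli numbers gives that coefficient (\<open>z_csc_fps_times_sin\<close>).
\<close>

section \<open>The Taylor series of z / sin z\<close>

lemma bernoulli_egf_scaled:
  fixes c :: complex
  shows "Abs_fps (\<lambda>k. of_real (bernoulli k) / fact k * c ^ k) * (fps_exp c - 1) = fps_const c * fps_X"
proof (rule fps_ext)
  fix n
  have 1: "fps_nth (fps_exp c - 1) k = c ^ k * of_real (fps_nth (fps_exp 1 - 1) k)" for k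
    by (cases k) auto
  have 2: "fps_nth (Abs_fps (\<lambda>k. of_real (bernoulli k) / fact k * c ^ k) * (fps_exp c - 1)) n
        = c ^ n * of_real (fps_nth (Abs_fps (\<lambda>k. bernoulli k / fact k) * (fps_exp 1 - 1)) n)"
    unfolding fps_mult_nth of_real_sum sum_distrib_left 1
  proof (intro sum.cong refl)
    fix i assume "i \<in> {0..n}"
    then have "c ^ n = c ^ i * c ^ (n - i)" by (simp flip: power_add)
    then show "fps_nth (Abs_fps (\<lambda>k. of_real (bernoulli k) / fact k * c ^ k)) i *
           (c ^ (n - i) * of_real (fps_nth (fps_exp 1 - 1) (n - i))) =
         c ^ n * of_real (fps_nth (Abs_fps (\<lambda>k. bernoulli k / fact k)) i * fps_nth (fps_exp 1 - 1) (n - i))"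
      by simp
  qed
  show "fps_nth (Abs_fps (\<lambda>k. of_real (bernoulli k) / fact k * c ^ k) * (fps_exp c - 1)) n
        = fps_nth (fps_const c * fps_X) n"
    unfolding 2 bernoulli_egf by (cases "n = 1") auto
qed

definition z_csc_fps :: "complex fps" where
  "z_csc_fps = Abs_fps (\<lambda>k. (2 - 2 ^ k) * \<i> ^ k * of_real (bernoulli k) / fact k)"

text \<open>
  If \<open>B\<^sub>c\<close> is the Bernoulli series at \<open>c z\<close>, then \<open>z / sin z = 2 B\<^sub>i - B\<^sub>2\<^sub>i\<close>, because with \<open>e = exp (i z)\<close>
  one has \<open>2 / (e - 1) - 2 / (e\<^sup>2 - 1) = 2 e / (e\<^sup>2 - 1)\<close> and \<open>sin z = (e\<^sup>2 - 1) / (2 i e)\<close>. The proof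
  below is this computation with the denominators cleared, as \<open>e - 1\<close> is not a unit of the ring of
  formal power series.
\<close>
lemma z_csc_fps_times_sin: "z_csc_fps * fps_sin 1 = fps_X"
proof -
  define B where "B = (\<lambda>c::complex. Abs_fps (\<lambda>k. of_real (bernoulli k) / fact k * c ^ k))"
  define e where "e = fps_exp \<i>"
  have e2: "fps_exp (2 * \<i>) = e * e"
    by (simp add: e_def flip: fps_exp_add_mult)
  have einv: "fps_exp (- \<i>) * e = 1"
    by (simp add: e_def flip: fps_exp_add_mult)
  have split: "z_csc_fps = fps_const 2 * B \<i> - B (2 * \<i>)"
    by (rule fps_ext) (simp add: z_csc_fps_def B_def power_mult_distrib field_simps)
  have "z_csc_fps * (e * e - 1) = fps_const 2 * (B \<i> * (e - 1)) * (e + 1) - B (2 * \<i>) * (e * e - 1)"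
    unfolding split by (simp add: algebra_simps)
  also have "\<dots> = fps_const (2 * \<i>) * fps_X * e"
    unfolding B_def e_def bernoulli_egf_scaled unfolding e_def[symmetric]
    using bernoulli_egf_scaled[of "2 * \<i>"] unfolding e2
    by (simp add: algebra_simps flip: fps_const_mult)
  finally have 1: "z_csc_fps * (e * e - 1) = fps_const (2 * \<i>) * fps_X * e" .
  have "fps_const (2 * \<i>) * fps_sin 1 = e - fps_exp (- \<i>)"
    unfolding e_def fps_sin_fps_exp_ii by simp
  then have "fps_const (2 * \<i>) * fps_sin 1 * e = e * e - 1"
    by (simp only: left_diff_distrib einv)
  then have "(fps_const (2 * \<i>) * e) * (z_csc_fps * fps_sin 1) = (fps_const (2 * \<i>) * e) * fps_X"
    using 1 by (simp add: mult_ac)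
  moreover have "fps_const (2 * \<i>) * e \<noteq> 0"
    by (simp add: e_def)
  ultimately show ?thesis
    using mult_left_cancel by blast
qed

definition z_csc :: "complex \<Rightarrow> complex" where
  "z_csc z = (if z = 0 then 1 else z / sin z)"

lemma z_csc_minus: "z_csc (- z) = z_csc z"
  by (simp add: z_csc_def)

lemma has_fps_expansion_z_csc: "z_csc has_fps_expansion z_csc_fps"
proof -
  have sd: "subdegree (fps_sin (1::complex)) = 1"
    by (rule subdegreeI) (auto simp: fps_sin_def)
  have sin1: "fps_nth (fps_sin (1::complex)) (Suc 0) = 1"
    by (simp add: fps_sin_def)
  have nz: "fps_sin (1::complex) \<noteq> 0"
    using sd by force
  have "(\<lambda>z. if z = 0 then 1 else z / sin z) has_fps_expansion (fps_X / fps_sin (1::complex))"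
    by (rule has_fps_expansion_divide[OF has_fps_expansion_fps_X has_fps_expansion_sin'])
       (use sd nz in \<open>auto simp: sin1\<close>)
  moreover have "fps_X / fps_sin 1 = z_csc_fps"
    using z_csc_fps_times_sin nz by (metis nonzero_mult_div_cancel_right)
  ultimately show ?thesis
    by (simp add: z_csc_def[abs_def])
qed

section \<open>Integrals over the circle\<close>

lemma sin_nonzero_in_ball:
  fixes z :: complex
  assumes "norm z < pi" "z \<noteq> 0"
  shows "sin z \<noteq> 0"
proof
  assume "sin z = 0"
  then obtain k :: int where k: "z = of_real (k * pi)" by (auto simp: sin_eq_0)
  then have "norm z = \<bar>of_int k\<bar> * pi" by (simp only: norm_of_real abs_mult) simp
  with assms(1) have "\<bar>real_of_int k\<bar> < 1" by simp
  then have "k = 0" by linarith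
  with k assms(2) show False by simp
qed

lemma holomorphic_z_csc: "z_csc holomorphic_on ball 0 pi"
proof -
  obtain s where s: "open s" "0 \<in> s" "z_csc holomorphic_on s"
    using has_fps_expansion_imp_holomorphic[OF has_fps_expansion_z_csc] by metis
  have "(\<lambda>z. z / sin z) holomorphic_on ball 0 pi - {0}"
    by (intro holomorphic_intros) (use sin_nonzero_in_ball in auto)
  then have "z_csc holomorphic_on ball 0 pi - {0}"
    by (rule holomorphic_transform) (auto simp: z_csc_def)
  with s(1,3) have "z_csc holomorphic_on s \<union> (ball 0 pi - {0})"
    by (intro holomorphic_on_Un) auto
  then show ?thesis
    by (rule holomorphic_on_subset) (use s(2) in auto)
qed

text \<open>
  This is Cauchy's formula for the \<open>k\<close>-th derivative at the centre, written as a Fourier integral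
  on the circle of radius \<open>r\<close>. The radius has to stay below \<open>\<pi>\<close>, the modulus of the nearest pole of
  \<open>1 / sin\<close> other than the origin.
\<close>
lemma z_csc_circle_integral:
  assumes "0 < r" "r < pi"
  shows "((\<lambda>t. z_csc (of_real r * cis t) / cis t ^ k) has_integral
           2 * pi * r ^ k * fps_nth z_csc_fps k) {0..2 * pi}"
proof -
  have "((\<lambda>u. z_csc u / (u - 0) ^ Suc k) has_contour_integral
          (2 * pi * \<i>) / fact k * (deriv ^^ k) z_csc 0) (circlepath 0 r)"
    by (rule Cauchy_has_contour_integral_higher_derivative_circlepath)
       (use assms in \<open>auto intro!: holomorphic_on_imp_continuous_on holomorphic_on_subset[OF holomorphic_z_csc]\<close>)
  also have "(2 * pi * \<i>) / fact k * (deriv ^^ k) z_csc 0 = 2 * pi * \<i> * fps_nth z_csc_fps k"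
    by (simp add: fps_nth_fps_expansion[OF has_fps_expansion_z_csc])
  finally have "((\<lambda>t. z_csc (of_real r * cis t) / (of_real r * cis t) ^ Suc k * r * \<i> * cis t) has_integral
                  2 * pi * \<i> * fps_nth z_csc_fps k) {0..2 * pi}"
    unfolding circlepath_def by (subst (asm) has_contour_integral_part_circlepath_iff) auto
  from has_integral_mult_right[OF this, of "of_real r ^ k / \<i>"]
  have "((\<lambda>t. of_real r ^ k / \<i> * (z_csc (of_real r * cis t) / (of_real r * cis t) ^ Suc k * r * \<i> * cis t))
          has_integral of_real r ^ k / \<i> * (2 * pi * \<i> * fps_nth z_csc_fps k)) {0..2 * pi}" .
  also have "(\<lambda>t. of_real r ^ k / \<i> * (z_csc (of_real r * cis t) / (of_real r * cis t) ^ Suc k * r * \<i> * cis t))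
             = (\<lambda>t. z_csc (of_real r * cis t) / cis t ^ k)"
  proof
    fix t
    have "of_real r * cis t \<noteq> 0"
      using assms by simp
    then show "of_real r ^ k / \<i> * (z_csc (of_real r * cis t) / (of_real r * cis t) ^ Suc k * r * \<i> * cis t)
               = z_csc (of_real r * cis t) / cis t ^ k"
      by (simp add: divide_simps power_mult_distrib del: complex_i_mult_minus divide_i)
  qed
  also have "of_real r ^ k / \<i> * (2 * pi * \<i> * fps_nth z_csc_fps k) = 2 * pi * r ^ k * fps_nth z_csc_fps k"
    by (simp add: divide_simps del: complex_i_mult_minus divide_i)
  finally show ?thesis .
qed

lemma has_integral_half_period:
  fixes h :: "real \<Rightarrow> complex"
  assumes periodic: "\<And>t. h (t + pi) = h t"
    and full: "(h has_integral I) {0..2 * pi}"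
  shows "(h has_integral I / 2) {- (pi / 2)..pi / 2}"
proof -
  have int: "h integrable_on {a..b}" if "0 \<le> a" "b \<le> 2 * pi" for a b
    by (rule integrable_subinterval_real[of h 0 "2 * pi"])
       (use full that in \<open>auto simp: integrable_on_def\<close>)
  obtain A B where A: "(h has_integral A) {0..pi / 2}" and B: "(h has_integral B) {pi / 2..pi}"
    using int[of 0 "pi / 2"] int[of "pi / 2" pi] by (auto simp: integrable_on_def)
  have AB: "(h has_integral A + B) {0..pi}"
    by (rule has_integral_combine[OF _ _ A B]) auto
  have "(h has_integral A + B) {pi..2 * pi}"
    using has_integral_shift_real_ivl_iff[of h "A + B" pi "2 * pi" pi] AB periodic by simp
  then have "(h has_integral (A + B) + (A + B)) {0..2 * pi}"
    by (intro has_integral_combine[OF _ _ AB]) auto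
  then have "I = (A + B) + (A + B)"
    using full has_integral_unique by blast
  then have I: "I / 2 = B + A"
    by simp
  have B': "(h has_integral B) {- (pi / 2)..0}"
    using has_integral_shift_real_ivl[OF B, of pi] periodic by simp
  have "(h has_integral B + A) {- (pi / 2)..pi / 2}"
    by (rule has_integral_combine[OF _ _ B' A]) auto
  then show ?thesis
    unfolding I .
qed

section \<open>The integrand\<close>

lemma cosh_minus_cos_eq_norm_sin:
  "cosh (2 * y) - cos (2 * x) = 2 * norm (sin (Complex x y)) ^ 2"
  unfolding norm_sin_squared by (simp add: cosh_def exp_minus field_simps)

text \<open>
  This is where the holomorphic function appears: the substitution \<open>w \<mapsto> \<pi> - w\<close> fixes
  \<open>sin w\<close> for \<open>w = x + i y\<close> and exchanges the two summands, so neither of them is a function of \<open>sin w\<close> and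
  \<open>a\<close> alone, but their sum can be.
\<close>
lemma symmetrised_numerator:
  fixes x y a :: real
  shows "sin (x + a) * exp (- y) + sin (x - a) * exp y = 2 * Re (cis a * sin (Complex x y))"
  by (simp add: Re_sin Im_sin sin_add sin_diff algebra_simps add_divide_distrib diff_divide_distrib)

theorem mainTheorem10:
  fixes n :: nat
  shows "((\<lambda>\<theta>::real.
            sin ((pi / 2) * cos \<theta> + (2 * real n - 1) * \<theta>) * exp (- (pi / 2) * sin \<theta>)
              / (cosh (pi * sin \<theta>) - cos (pi * cos \<theta>)))
          has_integral
            ((- 1) ^ n * bernoulli (2 * n) * pi ^ (2 * n)
              * ((2 powi (1 - 2 * int n) - 1) / Gamma (2 * real n + 1))))
          {- (pi / 2)..pi / 2}"
proof -
  define f where "f = (\<lambda>\<theta>::real.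
            sin ((pi / 2) * cos \<theta> + (2 * real n - 1) * \<theta>) * exp (- (pi / 2) * sin \<theta>)
              / (cosh (pi * sin \<theta>) - cos (pi * cos \<theta>)))"
  define w where "w = (\<lambda>\<theta>. of_real (pi / 2) * cis \<theta>)"
  define h where "h = (\<lambda>\<theta>. z_csc (w \<theta>) / cis \<theta> ^ (2 * n))"
  define c where "c = (2 - 4 ^ n) * (- 1) ^ n * bernoulli (2 * n) / fact (2 * n)"
  have w: "w \<theta> = Complex (pi / 2 * cos \<theta>) (pi / 2 * sin \<theta>)" for \<theta>
    by (simp add: w_def complex_eq_iff)
  have w0: "w \<theta> \<noteq> 0" for \<theta>
    by (simp add: w_def)
  have "norm (w \<theta>) < pi" for \<theta>
    by (simp only: w_def norm_mult norm_of_real norm_cis) simp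
  then have sinw: "sin (w \<theta>) \<noteq> 0" for \<theta>
    using w0 by (intro sin_nonzero_in_ball)
  have den: "cosh (pi * sin \<theta>) - cos (pi * cos \<theta>) = 2 * norm (sin (w \<theta>)) ^ 2" for \<theta>
    using cosh_minus_cos_eq_norm_sin[of "pi / 2 * sin \<theta>" "pi / 2 * cos \<theta>"] by (simp add: w)
  have den0: "cosh (pi * sin \<theta>) - cos (pi * cos \<theta>) \<noteq> 0" for \<theta>
    using sinw unfolding den by simp
  have coeff: "fps_nth z_csc_fps (2 * n) = of_real c"
    by (simp add: z_csc_fps_def c_def power_mult)

  have "((\<lambda>t. z_csc (of_real (pi / 2) * cis t) / cis t ^ (2 * n)) has_integral
           2 * pi * (pi / 2) ^ (2 * n) * fps_nth z_csc_fps (2 * n)) {0..2 * pi}"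
    using z_csc_circle_integral[of "pi / 2" "2 * n"] by simp
  then have "(h has_integral of_real (2 * pi * (pi / 2) ^ (2 * n) * c)) {0..2 * pi}"
    unfolding h_def w_def coeff by simp
  then have "(h has_integral of_real (2 * pi * (pi / 2) ^ (2 * n) * c) / 2) {- (pi / 2)..pi / 2}"
  proof (rule has_integral_half_period[rotated])
    fix t
    \<comment> \<open>The half turn changes the sign of \<open>w\<close>; both the even function and the even power absorb it.\<close>
    have "cis (t + pi) = - cis t" by (simp add: complex_eq_iff)
    then show "h (t + pi) = h t" by (simp add: h_def w_def z_csc_minus)
  qed
  from has_integral_linear[OF this bounded_linear_Re]
  have Reh: "((\<lambda>\<theta>. Re (h \<theta>)) has_integral pi * (pi / 2) ^ (2 * n) * c) {- (pi / 2)..pi / 2}"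
    by (simp add: o_def mult.assoc)

  have sym: "f \<theta> + f (- \<theta>) = 2 / pi * Re (h \<theta>)" for \<theta>
  proof -
    define a where "a = (2 * real n - 1) * \<theta>"
    have f1: "f \<theta> = sin (pi / 2 * cos \<theta> + a) * exp (- (pi / 2 * sin \<theta>)) / (2 * norm (sin (w \<theta>)) ^ 2)"
      unfolding f_def den a_def by simp
    have f2: "f (- \<theta>) = sin (pi / 2 * cos \<theta> - a) * exp (pi / 2 * sin \<theta>) / (2 * norm (sin (w \<theta>)) ^ 2)"
      unfolding f_def a_def den[symmetric] by simp
    have "f \<theta> + f (- \<theta>) = Re (cis a * sin (w \<theta>)) / norm (sin (w \<theta>)) ^ 2"
      unfolding f1 f2 add_divide_distrib[symmetric] symmetrised_numerator w
      by (rule mult_divide_mult_cancel_left) simp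
    \<comment> \<open>Conjugating inside the real part lets the denominator cancel down to \<open>sin w\<close>, which is
      holomorphic in \<open>w\<close>; otherwise its conjugate would remain.\<close>
    also have "\<dots> = Re (cnj (cis a * sin (w \<theta>))) / norm (sin (w \<theta>)) ^ 2"
      by simp
    also have "\<dots> = Re (cnj (cis a * sin (w \<theta>)) / of_real (norm (sin (w \<theta>)) ^ 2))"
      by (simp only: Re_divide_of_real)
    also have "of_real (norm (sin (w \<theta>)) ^ 2) = sin (w \<theta>) * cnj (sin (w \<theta>))"
      by (rule complex_norm_square)
    also have "cnj (cis a * sin (w \<theta>)) / (sin (w \<theta>) * cnj (sin (w \<theta>))) = cis (- a) / sin (w \<theta>)"
      using sinw[of \<theta>] by (simp add: cis_cnj)
    also have "cis (- a) = cis \<theta> / cis \<theta> ^ (2 * n)"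
      by (simp add: a_def Complex.DeMoivre cis_divide algebra_simps)
    also have "cis \<theta> / cis \<theta> ^ (2 * n) / sin (w \<theta>) = of_real (2 / pi) * h \<theta>"
      using w0[of \<theta>] by (simp add: h_def z_csc_def) (simp add: w_def)
    also have "Re \<dots> = 2 / pi * Re (h \<theta>)"
      by (simp only: Re_complex_of_real times_complex.sel Im_complex_of_real)
    finally show ?thesis .
  qed

  have "f integrable_on {- (pi / 2)..pi / 2}"
    unfolding f_def cosh_def using den0 unfolding cosh_def
    by (intro integrable_continuous_interval continuous_intros) auto
  then obtain I where I: "(f has_integral I) {- (pi / 2)..pi / 2}"
    by (auto simp: integrable_on_def)
  then have "((\<lambda>\<theta>. f (- \<theta>)) has_integral I) {- (pi / 2)..pi / 2}"
    using has_integral_reflect_real[where f = f and i = I and a = "- (pi / 2)" and b = "pi / 2"]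
    by (simp only: minus_minus)
  from has_integral_add[OF I this]
  have "((\<lambda>\<theta>. 2 / pi * Re (h \<theta>)) has_integral I + I) {- (pi / 2)..pi / 2}"
    unfolding sym .
  moreover have "((\<lambda>\<theta>. 2 / pi * Re (h \<theta>)) has_integral 2 / pi * (pi * (pi / 2) ^ (2 * n) * c))
      {- (pi / 2)..pi / 2}"
    using has_integral_mult_right[OF Reh, of "2 / pi"] .
  ultimately have "I + I = 2 / pi * (pi * (pi / 2) ^ (2 * n) * c)"
    by (rule has_integral_unique)
  then have "I = (pi / 2) ^ (2 * n) * c" by simp
  also have "\<dots> = (- 1) ^ n * bernoulli (2 * n) * pi ^ (2 * n)
                   * ((2 powi (1 - 2 * int n) - 1) / Gamma (2 * real n + 1))"
  proof -
    have "Gamma (2 * real n + 1) = fact (2 * n)"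
      using Gamma_fact[of "2 * n"] by (simp add: add_ac)
    moreover have "(2::real) powi (1 - 2 * int n) = 2 / 4 ^ n"
    proof -
      have "(2::real) powi (1 - int (2 * n)) = 2 / 2 ^ (2 * n)"
        by (subst power_int_diff) (auto simp only: power_int_of_nat, simp_all)
      then show ?thesis by (simp add: power_mult)
    qed
    moreover have "(pi / 2) ^ (2 * n) = pi ^ (2 * n) / 4 ^ n"
      by (simp add: power_divide power_mult)
    ultimately show ?thesis
      by (simp add: c_def field_simps)
  qed
  finally show ?thesis
    using I unfolding f_def by simp
qed

end
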